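(* For every integer $s\ge2$, \[ \begin{split} 2\sum_{i = 2}^{s-1} \binom {2s-i-1}{s-1}\sum_{\mu = 1}^\infty \frac{H_{\mu ,i} }{\mu ^{2s - i} } &=4\sum_{i = 1}^{\lfloor s/2\rfloor} \binom {2s-2i-1}{s-1}\zeta (2i)\zeta (2s - 2i) -2\binom {2s-2}{s-1}\sum_{i=2}^s(-1)^i\zeta(i)\zeta(2s-i)\\ &\quad -(-1)^{s-1}\zeta(s)^2\left[\binom {2s-2}{s-1}+(-1)^{s-1}-1\right] -(-1)^{s-1}\zeta(2s)\left[(-1)^{s-1}+1\right]. \end{split} \]
   Context: $H_{\mu,i}=\sum_{k=1}^\mu k^{-i}$ is a generalized harmonic number and $\zeta$ is the Riemann zeta function. Empty sums are zero. *)

theory Defs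
  imports Complex_Main
begin

definition gen_harm :: "nat \<Rightarrow> nat \<Rightarrow> real" where
  "gen_harm \<mu> i = (\<Sum>k = 1..\<mu>. 1 / real k ^ i)"

text \<open>
  The values of the Riemann zeta function at integers \<open>k \<ge> 2\<close>, given by its Dirichlet series
  \<open>1 + 1/2^k + 1/3^k + \<dots>\<close>. The series diverges for \<open>k \<le> 1\<close>, so the definition is meaningful
  for \<open>k \<ge> 2\<close> only.
\<close>
definition zeta :: "nat \<Rightarrow> real" where
  "zeta k = (\<Sum>n. 1 / real (Suc n) ^ k)"

end

(*
  Sum (-1)^s / (x^s y^s) over x > y >= 1. Directly this is (-1)^s (zeta(s)^2 - zeta(2s)) / 2.
  Expanding it in partial fractions with respect to n = x - y and summing over y first turns the
  i-th term into binomial(2s-i-1, s-1) ((1 + (-1)^i) zeta(i) zeta(2s-i) - S(i, 2s-i)), where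
  S(i, j) is the sum of H_{m,i} / m^j and zeta(1) has to be read as 0. The term S(1, 2s-1) is then
  eliminated by 2 S(1, 2s-1) = sum_{k=2}^{2s-2} (-1)^k zeta(k) zeta(2s-k), and S(s, s) by
  2 S(s, s) = zeta(s)^2 + zeta(2s).
*)
theory Submission
  imports Defs "HOL-Analysis.Infinite_Sum" "HOL-Analysis.Summation_Tests" "HOL-Real_Asymp.Real_Asymp"
begin

text \<open>With the token \<open>*s\<close> in scope, \<open>2*s\<close> does not parse as a product.\<close>
no_notation vector_scalar_mult (infixl \<open>*s\<close> 70)

section \<open>Interchange of summation\<close>

text \<open>Tonelli for series: nonnegativity turns \<open>sums\<close> into the order-independent
  \<open>has_sum\<close>, so the double sum over pairs exists and may be swapped. Convergence of the
  column totals \<open>h\<close> is part of the conclusion.\<close>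

lemma nonneg_sums_swap:
  fixes f :: "nat \<Rightarrow> nat \<Rightarrow> real"
  assumes nonneg: "\<And>m n. 0 \<le> f m n"
    and rows: "\<And>m. f m sums g m" and "g sums a"
    and cols: "\<And>n. (\<lambda>m. f m n) sums h n"
  shows "h sums a"
proof -
  have g0: "0 \<le> g m" for m
    using sums_le[OF _ sums_zero rows[of m]] nonneg by auto
  have "(g has_sum a) UNIV"
    using \<open>g sums a\<close> g0 by (intro sums_nonneg_imp_has_sum) auto
  moreover have row: "(f m has_sum g m) UNIV" for m
    using rows nonneg by (intro sums_nonneg_imp_has_sum) auto
  ultimately have "((\<lambda>(m, n). f m n) has_sum a) (UNIV \<times> UNIV)"
    using nonneg
    by (intro has_sum_SigmaI[where g = g] summable_on_SigmaI[where g = g])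
       (auto simp: summable_on_def)
  then have "((\<lambda>(n, m). f m n) has_sum a) (UNIV \<times> UNIV)"
    by (subst (asm) has_sum_swap) (simp add: case_prod_unfold)
  moreover have "((\<lambda>m. f m n) has_sum h n) UNIV" for n
    using cols nonneg by (intro sums_nonneg_imp_has_sum) auto
  then have "((\<lambda>m. (\<lambda>(n, m). f m n) (n, m)) has_sum h n) UNIV" for n
    by simp
  ultimately have "(h has_sum a) UNIV"
    by (rule has_sum_SigmaD)
  then show ?thesis
    by (rule has_sum_imp_sums)
qed

section \<open>Zeta values, harmonic numbers and convergence of Euler sums\<close>

lemma zeta_sums: "k \<ge> 2 \<Longrightarrow> (\<lambda>n. 1 / real (Suc n) ^ k) sums zeta k"
  unfolding zeta_def
  using inverse_power_summable[of k, where 'a = real]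
  by (intro summable_sums, subst summable_Suc_iff) (simp add: divide_inverse)

lemma gen_harm_Suc: "gen_harm (Suc n) k = gen_harm n k + 1 / real (Suc n) ^ k"
  by (simp add: gen_harm_def)

lemma gen_harm_lessThan: "gen_harm n k = (\<Sum>m<n. 1 / real (Suc m) ^ k)"
  by (induction n) (simp_all add: gen_harm_Suc, simp add: gen_harm_def)

lemma gen_harm_nonneg: "0 \<le> gen_harm n k"
  by (simp add: gen_harm_def sum_nonneg)

lemma gen_harm_le: "gen_harm n k \<le> real n"
proof -
  have "1 / real (Suc m) ^ k \<le> 1" for m
    by (simp add: divide_le_eq one_le_power del: of_nat_Suc)
  then show ?thesis
    using sum_mono[of "{..<n}" "\<lambda>m. 1 / real (Suc m) ^ k" "\<lambda>_. 1"]
    by (simp add: gen_harm_lessThan del: of_nat_Suc)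
qed

lemma zeta_tail_sums:
  assumes "k \<ge> 2"
  shows "(\<lambda>m. 1 / real (n + Suc m) ^ k) sums (zeta k - gen_harm n k)"
  using sums_split_initial_segment[OF zeta_sums[OF assms], of n]
  by (simp add: gen_harm_lessThan add_ac)

text \<open>The counterpart of \<open>zeta_tail_sums\<close> at exponent 1: only the difference of
  the two divergent series converges. Raising \<open>n\<close> by one adds a telescoping series with
  sum \<open>1 / real (Suc n)\<close>.\<close>

lemma harm_sums: "(\<lambda>m. 1 / real (Suc m) - 1 / real (n + Suc m)) sums gen_harm n 1"
proof (induction n)
  case 0
  then show ?case
    by (simp add: gen_harm_def)
next
  case (Suc n)
  have "(\<lambda>m. 1 / real (n + Suc m)) \<longlonglongrightarrow> 0"
    by real_asymp
  from telescope_sums'[OF this]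
  have "(\<lambda>m. 1 / real (n + Suc m) - 1 / real (Suc n + Suc m)) sums (1 / real (Suc n))"
    by simp
  from sums_add[OF Suc this] show ?case
    by (simp add: gen_harm_Suc)
qed

definition euler_sum :: "nat \<Rightarrow> nat \<Rightarrow> real" where
  "euler_sum i j = (\<Sum>m. gen_harm (Suc m) i / real (Suc m) ^ j)"

text \<open>Bounding the harmonic number by \<open>Suc m\<close> costs one power of the denominator,
  hence 3 rather than 2 in the hypothesis.\<close>

lemma euler_sum_sums:
  assumes "j \<ge> 3"
  shows "(\<lambda>m. gen_harm (Suc m) i / real (Suc m) ^ j) sums euler_sum i j"
  unfolding euler_sum_def
proof (rule summable_sums, rule summable_comparison_test'[of "\<lambda>m. 1 / real (Suc m) ^ (j - 1)" 0])
  show "summable (\<lambda>m. 1 / real (Suc m) ^ (j - 1))"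
    by (rule sums_summable[OF zeta_sums]) (use assms in auto)
  fix m
  have "real (Suc m) ^ j = real (Suc m) * real (Suc m) ^ (j - 1)"
    using assms by (cases j) auto
  then show "norm (gen_harm (Suc m) i / real (Suc m) ^ j) \<le> 1 / real (Suc m) ^ (j - 1)"
    using gen_harm_le[of "Suc m" i] gen_harm_nonneg[of "Suc m" i]
    by (simp add: field_simps del: of_nat_Suc)
qed

text \<open>Squaring a partial sum of zeta counts each pair of distinct indices twice and the
  diagonal once. This also supplies convergence at \<open>k = 2\<close>, outside the range of
  \<open>euler_sum_sums\<close>.\<close>

lemma euler_sum_diagonal:
  assumes "k \<ge> 2"
  shows "(\<lambda>m. gen_harm (Suc m) k / real (Suc m) ^ k) sums (((zeta k)\<^sup>2 + zeta (2 * k)) / 2)"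
proof -
  have partial: "(\<Sum>m<n. gen_harm (Suc m) k / real (Suc m) ^ k) =
      ((gen_harm n k)\<^sup>2 + gen_harm n (2 * k)) / 2" for n
  proof (induction n)
    case (Suc n)
    define u where "u = 1 / real (Suc n) ^ k"
    have u2: "1 / real (Suc n) ^ (2 * k) = u\<^sup>2"
      by (simp add: u_def power_divide mult.commute flip: power_mult)
    have last: "gen_harm (Suc n) k / real (Suc n) ^ k = (gen_harm n k + u) * u"
      by (simp add: gen_harm_Suc u_def)
    have "(\<Sum>m<Suc n. gen_harm (Suc m) k / real (Suc m) ^ k) =
        ((gen_harm n k)\<^sup>2 + gen_harm n (2 * k)) / 2 + (gen_harm n k + u) * u"
      by (simp only: sum.lessThan_Suc Suc last)
    also have "\<dots> = ((gen_harm n k + u)\<^sup>2 + (gen_harm n (2 * k) + u\<^sup>2)) / 2"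
      by (simp add: power2_eq_square field_simps)
    finally show ?case
      by (simp only: gen_harm_Suc u2 u_def)
  qed (simp add: gen_harm_def)
  have lim: "(\<lambda>n. gen_harm n j) \<longlonglongrightarrow> zeta j" if "j \<ge> 2" for j
    using zeta_sums[OF that] by (simp add: sums_def gen_harm_lessThan)
  show ?thesis
    unfolding sums_def partial by (intro tendsto_intros lim) (use assms in auto)
qed

section \<open>The Euler sum with harmonic numbers of order one\<close>

text \<open>Multiplication by \<open>a + b\<close> makes the sum telescope. The last index
  \<open>2 * s + 3\<close> is odd, so both end terms come out with a plus sign.\<close>

lemma geometric_alternating:
  fixes a b :: real
  shows "(\<Sum>k=2..2 * s + 2. (-1) ^ k * a ^ k * b ^ (2 * s + 4 - k)) * (a + b) =
    a\<^sup>2 * b ^ (2 * s + 3) + a ^ (2 * s + 3) * b\<^sup>2"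
proof -
  define F where "F k = (-1) ^ k * a ^ k * b ^ (2 * s + 5 - k)" for k
  have "(\<Sum>k=2..2 * s + 2. (-1) ^ k * a ^ k * b ^ (2 * s + 4 - k)) * (a + b) =
    (\<Sum>k=2..2 * s + 2. F k - F (Suc k))"
    unfolding sum_distrib_right
  proof (rule sum.cong)
    fix k assume "k \<in> {2..2 * s + 2}"
    then have "2 * s + 5 - k = Suc (2 * s + 4 - k)"
      by auto
    then show "(-1) ^ k * a ^ k * b ^ (2 * s + 4 - k) * (a + b) = F k - F (Suc k)"
      by (simp add: F_def algebra_simps)
  qed simp
  also have "\<dots> = F 2 - F (2 * s + 3)"
    using sum_Suc_diff[of 2 "2 * s + 2" "\<lambda>k. - F k"] by (simp add: numeral_eq_Suc)
  also have "F 2 - F (2 * s + 3) = a\<^sup>2 * b ^ (2 * s + 3) + a ^ (2 * s + 3) * b\<^sup>2"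
    by (simp add: F_def uminus_power_if add.commute)
  finally show ?thesis .
qed

text \<open>
  Summed over \<open>m\<close>, \<open>1 / (m * (m + n))\<close> gives \<open>gen_harm n 1 / n\<close>; the alternating geometric sum
  of \<open>1 / (m ^ k * n ^ (2 * s - k))\<close> is a sum of two such terms, one with \<open>m\<close> and \<open>n\<close> exchanged.
\<close>
lemma euler_sum_1:
  assumes "s \<ge> 2"
  shows "2 * euler_sum 1 (2 * s - 1) = (\<Sum>k=2..2 * s - 2. (-1) ^ k * zeta k * zeta (2 * s - k))"
proof -
  obtain t where t: "s = t + 2"
    using assms by (metis le_Suc_ex add.commute)
  define f where "f n m = 1 / (real (Suc m) * real (Suc n) ^ (2 * t + 2) * real (Suc n + Suc m))"
    for n m
  define A where "A n m = (\<Sum>k=2..2 * t + 2.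
      (-1) ^ k * (1 / real (Suc m) ^ k) * (1 / real (Suc n) ^ (2 * t + 4 - k)))" for n m
  have f: "f n sums (gen_harm (Suc n) 1 / real (Suc n) ^ (2 * t + 3))" for n
  proof -
    \<comment> \<open>Partial fractions in \<open>m\<close>: 1/(m(m+n)) = (1/m - 1/(m+n))/n.\<close>
    have "f n = (\<lambda>m. (1 / real (Suc m) - 1 / real (Suc n + Suc m)) / real (Suc n) ^ (2 * t + 3))"
      by (rule ext) (simp add: f_def divide_simps numeral_eq_Suc)
    then show ?thesis
      using sums_divide[OF harm_sums[of "Suc n"]] by simp
  qed
  \<comment> \<open>With a = 1/m and b = 1/n, 1/(m+n) equals ab/(a+b), so \<open>f\<close> becomes
    one end term of the telescoped sum divided by a+b.\<close>
  have f_inverse: "1 / (1 / a * (1 / b) ^ (2 * t + 2) * (1 / b + 1 / a)) * (a + b) =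
      a\<^sup>2 * b ^ (2 * t + 3)" if "a > 0" "b > 0" for a b :: real
  proof -
    have "1 / b + 1 / a = (a + b) / (a * b)" "a + b \<noteq> 0"
      using that by (auto simp: field_simps)
    then show ?thesis
      using that by (simp add: power_one_over numeral_eq_Suc)
  qed
  have A: "A n m = f n m + f m n" for n m
  proof -
    define a b where "a = 1 / real (Suc m)" and "b = 1 / real (Suc n)"
    have pos: "a > 0" "b > 0"
      by (auto simp: a_def b_def)
    have "A n m * (a + b) = a\<^sup>2 * b ^ (2 * t + 3) + a ^ (2 * t + 3) * b\<^sup>2"
      unfolding A_def using geometric_alternating[of a b t]
      by (simp add: a_def b_def power_one_over del: of_nat_Suc)
    moreover have "real (Suc m) = 1 / a" "real (Suc n) = 1 / b"
      by (auto simp: a_def b_def)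
    then have "f n m * (a + b) = a\<^sup>2 * b ^ (2 * t + 3)" "f m n * (b + a) = b\<^sup>2 * a ^ (2 * t + 3)"
      unfolding f_def of_nat_add by (simp_all only: f_inverse pos)
    ultimately have "A n m * (a + b) = (f n m + f m n) * (a + b)"
      by (simp add: algebra_simps)
    then show ?thesis
      using pos by simp
  qed
  \<comment> \<open>The columns of \<open>f\<close> get no closed form; they converge as the
    difference of \<open>A n\<close> and a row of \<open>f\<close>.\<close>
  have f': "(\<lambda>m. f m n) sums (\<Sum>m. f m n)" for n
  proof -
    have "(\<lambda>m. A n m - f n m) sums
      ((\<Sum>k=2..2 * t + 2. (-1) ^ k * zeta k * (1 / real (Suc n) ^ (2 * t + 4 - k))) -
        gen_harm (Suc n) 1 / real (Suc n) ^ (2 * t + 3))"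
      unfolding A_def by (intro sums_diff sums_sum sums_mult sums_mult2 zeta_sums f) auto
    then show ?thesis
      by (simp add: A sums_iff)
  qed
  have S: "(\<lambda>n. gen_harm (Suc n) 1 / real (Suc n) ^ (2 * t + 3)) sums euler_sum 1 (2 * t + 3)"
    by (rule euler_sum_sums) simp
  \<comment> \<open>Transposing \<open>f\<close> preserves its total, so \<open>A\<close> has twice
    the Euler sum as its total.\<close>
  have S': "(\<lambda>n. \<Sum>m. f m n) sums euler_sum 1 (2 * t + 3)"
    by (rule nonneg_sums_swap[OF _ f S f']) (simp add: f_def)
  have "A n sums (\<Sum>k=2..2 * t + 2. (-1) ^ k * zeta k * (1 / real (Suc n) ^ (2 * t + 4 - k)))" for n
    unfolding A_def by (intro sums_sum sums_mult sums_mult2 zeta_sums) auto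
  moreover have "A n sums (gen_harm (Suc n) 1 / real (Suc n) ^ (2 * t + 3) + (\<Sum>m. f m n))" for n
    unfolding A by (intro sums_add f f')
  ultimately have eq: "(\<lambda>n. gen_harm (Suc n) 1 / real (Suc n) ^ (2 * t + 3) + (\<Sum>m. f m n)) =
    (\<lambda>n. \<Sum>k=2..2 * t + 2. (-1) ^ k * zeta k * (1 / real (Suc n) ^ (2 * t + 4 - k)))"
    using sums_unique2 by blast
  have "(\<lambda>n. \<Sum>k=2..2 * t + 2. (-1) ^ k * zeta k * (1 / real (Suc n) ^ (2 * t + 4 - k))) sums
    (\<Sum>k=2..2 * t + 2. (-1) ^ k * zeta k * zeta (2 * t + 4 - k))"
    by (intro sums_sum sums_mult zeta_sums) auto
  from sums_unique2[OF sums_add[OF S S', unfolded eq] this]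
  have "2 * euler_sum 1 (2 * t + 3) =
    (\<Sum>k=2..2 * t + 2. (-1) ^ k * zeta k * zeta (2 * t + 4 - k))"
    by (simp only: mult_2[of "euler_sum 1 (2 * t + 3)"])
  moreover have "2 * t + 3 = 2 * s - 1" "2 * t + 2 = 2 * s - 2" "2 * t + 4 = 2 * s"
    using t by auto
  ultimately show ?thesis
    by (simp only:)
qed

section \<open>Partial fractions and the linear relation between Euler sums\<close>

text \<open>The symmetric case of the Chaundy-Bullard identity. In the induction the two halves
  change by multiples of \<open>1 - 2 * p\<close> and \<open>1 - 2 * q\<close> with a common factor,
  and these cancel because \<open>p + q = 1\<close>.\<close>

lemma partial_fractions_unit:
  fixes p q :: "'a :: comm_ring_1"
  assumes "p + q = 1"
  shows "(\<Sum>k\<le>s. of_nat ((s + k) choose s) * (p ^ k * q ^ Suc s + q ^ k * p ^ Suc s)) = 1"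
proof (induction s)
  case 0
  then show ?case
    using assms by (simp add: add.commute)
next
  case (Suc s)
  define A where "A s x = (\<Sum>k\<le>s. of_nat ((s + k) choose s) * x ^ k)" for s and x :: 'a
  define c :: 'a where "c = of_nat ((2 * s + 1) choose s)"
  have c: "of_nat ((2 * s + 2) choose Suc s) = 2 * c" "of_nat ((2 * s + 1) choose Suc s) = c"
    using binomial_symmetric[of s "2 * s + 1"] by (simp_all add: c_def)
  \<comment> \<open>Pascal's rule splits \<open>A (Suc s) x\<close> into \<open>A s x\<close> and
    \<open>x * A (Suc s) x\<close>, up to boundary terms. Those have coefficients \<open>c\<close>
    and \<open>2 * c\<close>, the central binomial coefficient being twice its neighbour in the row
    above.\<close>
  have step: "(1 - x) * A (Suc s) x = A s x + c * x ^ Suc s * (1 - 2 * x)" for x :: 'a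
  proof -
    have "A (Suc s) x =
      1 + (\<Sum>k\<le>s. of_nat ((Suc s + Suc k) choose Suc s) * x ^ Suc k)"
      unfolding A_def by (subst sum.atMost_Suc_shift) simp
    also have "\<dots> = 1 + (\<Sum>k\<le>s. of_nat ((s + Suc k) choose s) * x ^ Suc k) +
        (\<Sum>k\<le>s. of_nat ((Suc s + k) choose Suc s) * x ^ Suc k)"
      by (simp add: sum.distrib algebra_simps)
    also have "1 + (\<Sum>k\<le>s. of_nat ((s + Suc k) choose s) * x ^ Suc k) =
        (\<Sum>k\<le>Suc s. of_nat ((s + k) choose s) * x ^ k)"
      by (subst sum.atMost_Suc_shift) simp
    also have "\<dots> = A s x + c * x ^ Suc s"
      by (simp add: A_def c_def mult_2)
    also have "(\<Sum>k\<le>s. of_nat ((Suc s + k) choose Suc s) * x ^ Suc k) =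
        x * (\<Sum>k\<le>s. of_nat ((Suc s + k) choose Suc s) * x ^ k)"
      by (simp add: sum_distrib_left mult.left_commute del: binomial_Suc_Suc)
    also have "\<dots> = x * (A (Suc s) x - 2 * c * x ^ Suc s)"
    proof -
      have "Suc s + Suc s = 2 * s + 2"
        by simp
      then show ?thesis
        by (simp only: A_def sum.atMost_Suc c(1) add_diff_cancel_right')
    qed
    finally show ?thesis
      by (simp add: algebra_simps)
  qed
  have split: "(\<Sum>k\<le>s. of_nat ((s + k) choose s) * (p ^ k * q ^ Suc s + q ^ k * p ^ Suc s)) =
      q ^ Suc s * A s p + p ^ Suc s * A s q" for s
    by (simp add: A_def sum_distrib_left sum.distrib algebra_simps)
  have pq: "1 - p = q" "1 - q = p"
    using assms by (auto simp: algebra_simps)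
  have "q ^ Suc (Suc s) * A (Suc s) p + p ^ Suc (Suc s) * A (Suc s) q =
    q ^ Suc s * ((1 - p) * A (Suc s) p) + p ^ Suc s * ((1 - q) * A (Suc s) q)"
    unfolding pq by (simp add: algebra_simps)
  also have "\<dots> = (q ^ Suc s * A s p + p ^ Suc s * A s q) +
      2 * c * p ^ Suc s * q ^ Suc s * (1 - (p + q))"
    unfolding step by (simp add: algebra_simps)
  finally show ?case
    using Suc assms unfolding split by simp
qed

text \<open>Scaling by \<open>n\<close> gives \<open>p = x / n\<close> and
  \<open>q = - y / n\<close> with sum 1; dividing the unit identity by
  \<open>p ^ s * q ^ s * n ^ (2 * s)\<close> yields the expansion. The signs come from the negative
  \<open>q\<close>, and the index is \<open>i = s - k\<close>.\<close>

lemma partial_fractions: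
  fixes x y n :: real
  assumes "n > 0" "y > 0" "x = n + y" "s \<ge> 1"
  shows "(-1) ^ s * (1 / (x ^ s * y ^ s)) =
    (\<Sum>i=1..s. real ((2 * s - i - 1) choose (s - 1)) *
       ((1 / x ^ i + (-1) ^ i * (1 / y ^ i)) * (1 / n ^ (2 * s - i))))"
proof -
  obtain t where t: "s = Suc t"
    using \<open>s \<ge> 1\<close> by (cases s) auto
  define p q where "p = x / n" and "q = - y / n"
  have pq: "p \<noteq> 0" "q \<noteq> 0" "p + q = 1" and "x > 0"
    using assms by (auto simp: p_def q_def field_simps)
  have "p ^ s * q ^ s * n ^ (2 * s) = (p * q * n\<^sup>2) ^ s"
    by (simp add: power_mult_distrib power_mult)
  also have "p * q * n\<^sup>2 = - (x * y)"
    using assms by (simp add: p_def q_def power2_eq_square)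
  also have "(- (x * y)) ^ s = (-1) ^ s * (x ^ s * y ^ s)"
    by (simp add: power_minus[of "x * y"] power_mult_distrib)
  finally have "(-1) ^ s * (1 / (x ^ s * y ^ s)) = 1 / (p ^ s * q ^ s * n ^ (2 * s))"
    by (cases "even s") simp_all
  also have "\<dots> = (\<Sum>k\<le>t. real ((t + k) choose t) * (p ^ k * q ^ s + q ^ k * p ^ s)) /
      (p ^ s * q ^ s * n ^ (2 * s))"
    using partial_fractions_unit[OF pq(3), of t] by (simp add: t)
  also have "\<dots> = (\<Sum>k\<le>t. real ((t + k) choose t) *
      ((1 / x ^ (s - k) + (-1) ^ (s - k) * (1 / y ^ (s - k))) * (1 / n ^ (s + k))))"
    unfolding sum_divide_distrib
  proof (rule sum.cong)
    fix k assume "k \<in> {..t}"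
    then obtain j where j: "s = k + j"
      using t by (metis atMost_iff le_Suc_ex le_SucI)
    have "p ^ k * q ^ s + q ^ k * p ^ s = (p ^ k * q ^ k) * (p ^ j + q ^ j)"
      by (simp add: j power_add algebra_simps)
    moreover have "p ^ s * q ^ s * n ^ (2 * s) = (p ^ k * q ^ k) * (p ^ j * q ^ j * n ^ (2 * s))"
      unfolding j power_add by (simp add: mult_ac)
    moreover have "(p ^ j + q ^ j) / (p ^ j * q ^ j * n ^ (2 * s)) =
        (1 / p ^ j + 1 / q ^ j) / n ^ (2 * s)"
      using pq \<open>n > 0\<close> by (simp add: field_simps)
    ultimately have "(p ^ k * q ^ s + q ^ k * p ^ s) / (p ^ s * q ^ s * n ^ (2 * s)) =
        (1 / p ^ j + 1 / q ^ j) / n ^ (2 * s)"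
      using pq by (simp only: mult_divide_mult_cancel_left_if) simp
    also have "\<dots> = (1 / x ^ j + (-1) ^ j * (1 / y ^ j)) * (n ^ j / n ^ (2 * s))"
    proof -
      have "1 / p ^ j = (1 / x ^ j) * n ^ j"
        by (simp add: p_def power_divide)
      moreover have "1 / q ^ j = (-1) ^ j * (1 / y ^ j) * n ^ j"
        by (simp add: q_def power_divide power_minus[of y] uminus_power_if)
      ultimately show ?thesis
        by (simp add: algebra_simps add_divide_distrib)
    qed
    also have "n ^ j / n ^ (2 * s) = 1 / n ^ (s + k)"
      using \<open>n > 0\<close> by (simp add: j mult_2 power_add)
    finally show "real ((t + k) choose t) * (p ^ k * q ^ s + q ^ k * p ^ s) /
        (p ^ s * q ^ s * n ^ (2 * s)) = real ((t + k) choose t) *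
      ((1 / x ^ (s - k) + (-1) ^ (s - k) * (1 / y ^ (s - k))) * (1 / n ^ (s + k)))"
      using j by (simp flip: times_divide_eq_right)
  qed simp
  also have "\<dots> = (\<Sum>i=1..s. real ((2 * s - i - 1) choose (s - 1)) *
       ((1 / x ^ i + (-1) ^ i * (1 / y ^ i)) * (1 / n ^ (2 * s - i))))"
    by (rule sum.reindex_bij_witness[of _ "\<lambda>i. s - i" "\<lambda>k. s - k"])
       (auto simp: t Suc_diff_le mult_2)
  finally show ?thesis .
qed

text \<open>
  The column sums over \<open>y\<close> of the partial fractions of \<open>1 / ((n + y) ^ s * y ^ s)\<close>. For \<open>i = 1\<close>
  the two parts converge only together, and the divergent \<open>zeta 1\<close> drops out.
\<close>
lemma zeta_even_euler_sum:
  assumes "s \<ge> 2"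
  shows "(-1) ^ s * ((zeta s)\<^sup>2 - euler_sum s s) =
    (\<Sum>i=1..s. real ((2 * s - i - 1) choose (s - 1)) *
      ((if i = 1 then 0 else (1 + (-1) ^ i) * zeta i) * zeta (2 * s - i) - euler_sum i (2 * s - i)))"
proof -
  define e where "e i = (if i = 1 then 0 else (1 + (-1) ^ i) * zeta i)" for i
  define c where "c i = real ((2 * s - i - 1) choose (s - 1))" for i
  define T where "T = (\<lambda>y n. 1 / real (Suc y + Suc n) ^ s * (1 / real (Suc y) ^ s))"
  define R where "R n = (\<Sum>i=1..s. c i * ((e i - gen_harm (Suc n) i) * (1 / real (Suc n) ^ (2 * s - i))))"
    for n
  have diag: "(\<lambda>m. gen_harm (Suc m) s / real (Suc m) ^ s) sums euler_sum s s"
    using euler_sum_diagonal[OF assms] by (simp add: euler_sum_def sums_iff)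
  have rows: "T y sums ((zeta s - gen_harm (Suc y) s) * (1 / real (Suc y) ^ s))" for y
    unfolding T_def by (intro sums_mult2 zeta_tail_sums assms)
  \<comment> \<open>Here \<open>x = y + n\<close>. Summing over \<open>n\<close> first leaves a zeta
    tail, and summing over \<open>y\<close> then gives the sum over all x > y.\<close>
  have total: "(\<lambda>y. (zeta s - gen_harm (Suc y) s) * (1 / real (Suc y) ^ s)) sums
      ((zeta s)\<^sup>2 - euler_sum s s)"
    using sums_diff[OF sums_mult[OF zeta_sums[OF assms], of "zeta s"] diag]
    by (simp add: power2_eq_square algebra_simps diff_divide_distrib)
  have part: "(\<lambda>y. 1 / real (Suc n + Suc y) ^ i + (-1) ^ i * (1 / real (Suc y) ^ i)) sums
      (e i - gen_harm (Suc n) i)" if "i \<in> {1..s}" for n i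
  proof (cases "i = 1")
    case True
    then show ?thesis
      using sums_minus[OF harm_sums[of "Suc n"]] by (simp add: e_def)
  next
    case False
    with that have "i \<ge> 2"
      by auto
    with False show ?thesis
      using sums_add[OF zeta_tail_sums[of i "Suc n"] sums_mult[OF zeta_sums[of i], of "(-1) ^ i"]]
      by (simp add: e_def algebra_simps)
  qed
  have "(\<lambda>y. (-1) ^ s * T y n) sums R n" for n
  proof -
    have "(\<lambda>y. \<Sum>i=1..s. c i * ((1 / real (Suc n + Suc y) ^ i + (-1) ^ i * (1 / real (Suc y) ^ i)) *
        (1 / real (Suc n) ^ (2 * s - i)))) sums R n"
      unfolding R_def by (intro sums_sum sums_mult sums_mult2 part)
    moreover have "T y n = 1 / (real (Suc n + Suc y) ^ s * real (Suc y) ^ s)" for y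
      unfolding T_def by (subst add.commute) simp
    then have "(-1) ^ s * T y n = (\<Sum>i=1..s. c i *
        ((1 / real (Suc n + Suc y) ^ i + (-1) ^ i * (1 / real (Suc y) ^ i)) *
        (1 / real (Suc n) ^ (2 * s - i))))" for y
      unfolding c_def using assms by (simp only:) (rule partial_fractions, auto)
    ultimately show ?thesis
      by simp
  qed
  \<comment> \<open>The sign is moved to the other side, since the interchange needs nonnegative
    terms.\<close>
  from sums_mult[OF this, of "(-1) ^ s"]
  have "(\<lambda>y. T y n) sums ((-1) ^ s * R n)" for n
    by (simp flip: mult.assoc power_add mult_2)
  from nonneg_sums_swap[OF _ rows total this]
  have "(\<lambda>n. (-1) ^ s * R n) sums ((zeta s)\<^sup>2 - euler_sum s s)"
    by (simp add: T_def)
  from sums_mult[OF this, of "(-1) ^ s"]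
  have "R sums ((-1) ^ s * ((zeta s)\<^sup>2 - euler_sum s s))"
    by (simp flip: mult.assoc power_add mult_2)
  moreover have "R sums (\<Sum>i=1..s. c i * (e i * zeta (2 * s - i) - euler_sum i (2 * s - i)))"
    unfolding R_def
  proof (intro sums_sum sums_mult)
    fix i assume i: "i \<in> {1..s}"
    have "(\<lambda>n. gen_harm (Suc n) i / real (Suc n) ^ (2 * s - i)) sums euler_sum i (2 * s - i)"
    \<comment> \<open>For \<open>i < s\<close> the exponent is at least \<open>s + 1\<close>, hence
      at least 3; at \<open>i = s\<close> it may be 2, and the diagonal case takes over.\<close>
    proof (cases "i = s")
      case True
      then show ?thesis
        using diag by (simp add: mult_2)
    next
      case False
      with i assms show ?thesis
        by (intro euler_sum_sums) auto
    qed
    moreover have "2 * s - i \<ge> 2"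
      using i assms by auto
    ultimately have "(\<lambda>n. e i * (1 / real (Suc n) ^ (2 * s - i)) -
        gen_harm (Suc n) i / real (Suc n) ^ (2 * s - i)) sums
        (e i * zeta (2 * s - i) - euler_sum i (2 * s - i))"
      by (intro sums_diff sums_mult zeta_sums)
    then show "(\<lambda>n. (e i - gen_harm (Suc n) i) * (1 / real (Suc n) ^ (2 * s - i))) sums
        (e i * zeta (2 * s - i) - euler_sum i (2 * s - i))"
      by (simp add: diff_divide_distrib)
  qed
  ultimately show ?thesis
    unfolding c_def e_def by (rule sums_unique2)
qed

section \<open>Finite reindexing and assembly\<close>

lemma sum_even_indices:
  fixes g :: "nat \<Rightarrow> 'a :: comm_semiring_1"
  shows "(\<Sum>i=1..s. if even i then g i else 0) = (\<Sum>i=1..s div 2. g (2 * i))"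
proof -
  have "(\<Sum>i=1..s. if even i then g i else 0) = sum g {i \<in> {1..s}. even i}"
    by (rule sum.inter_filter[symmetric]) simp
  also have "\<dots> = (\<Sum>i=1..s div 2. g (2 * i))"
    by (rule sum.reindex_bij_witness[of _ "\<lambda>i. 2 * i" "\<lambda>i. i div 2"]) (auto elim: evenE)
  finally show ?thesis .
qed

text \<open>Reflection about \<open>s\<close> carries the upper half to the lower half and fixes
  \<open>s\<close>, so doubling counts the middle term once too often.\<close>

lemma sum_symmetric_halves:
  fixes g :: "nat \<Rightarrow> 'a :: comm_ring_1"
  assumes "s \<ge> 2" and sym: "\<And>k. k \<in> {2..2 * s - 2} \<Longrightarrow> g (2 * s - k) = g k"
  shows "(\<Sum>k=2..2 * s - 2. g k) = 2 * (\<Sum>k=2..s. g k) - g s"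
proof -
  have "{2..2 * s - 2} = {2..s} \<union> {s<..2 * s - 2}"
    using \<open>s \<ge> 2\<close> by auto
  then have "(\<Sum>k=2..2 * s - 2. g k) = (\<Sum>k=2..s. g k) + (\<Sum>k\<in>{s<..2 * s - 2}. g k)"
    by (simp only:) (rule sum.union_disjoint, auto)
  also have "(\<Sum>k\<in>{s<..2 * s - 2}. g k) = (\<Sum>k\<in>{2..<s}. g k)"
    by (rule sum.reindex_bij_witness[of _ "\<lambda>k. 2 * s - k" "\<lambda>k. 2 * s - k"])
       (auto intro!: sym)
  also have "(\<Sum>k\<in>{2..<s}. g k) = (\<Sum>k=2..s. g k) - g s"
    using \<open>s \<ge> 2\<close> by (simp add: sum.last_plus)
  finally show ?thesis
    by simp
qed

theorem theorem5p10:
  fixes s :: nat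
  assumes "s \<ge> 2"
  shows "2 * (\<Sum>i = 2..s - 1. real ((2*s - i - 1) choose (s - 1)) *
             (\<Sum>m. gen_harm (Suc m) i / real (Suc m) ^ (2*s - i)))
       = 4 * (\<Sum>i = 1..s div 2. real ((2*s - 2*i - 1) choose (s - 1)) * zeta (2*i) * zeta (2*s - 2*i))
         - 2 * real ((2*s - 2) choose (s - 1)) * (\<Sum>i = 2..s. (-1) ^ i * zeta i * zeta (2*s - i))
         - (-1) ^ (s - 1) * (zeta s)\<^sup>2 * (real ((2*s - 2) choose (s - 1)) + (-1) ^ (s - 1) - 1)
         - (-1) ^ (s - 1) * zeta (2*s) * ((-1) ^ (s - 1) + 1)"
proof -
  define c where "c i = real ((2 * s - i - 1) choose (s - 1))" for i
  define E where "E = (\<Sum>i=1..s div 2. c (2 * i) * zeta (2 * i) * zeta (2 * s - 2 * i))"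
  define L where "L = (\<Sum>i=2..s - 1. c i * euler_sum i (2 * s - i))"
  define A where "A = (\<Sum>i=2..s. (-1) ^ i * zeta i * zeta (2 * s - i))"
  have diag: "euler_sum s s = ((zeta s)\<^sup>2 + zeta (2 * s)) / 2"
    using euler_sum_diagonal[OF assms] by (simp add: euler_sum_def sums_iff)
  \<comment> \<open>The factor \<open>1 + (-1) ^ i\<close> is 2 or 0 by parity, and the value 0 at
    \<open>i = 1\<close> fits the odd case.\<close>
  have "(\<Sum>i=1..s. c i * ((if i = 1 then 0 else (1 + (-1) ^ i) * zeta i) * zeta (2 * s - i))) =
      (\<Sum>i=1..s. if even i then 2 * (c i * zeta i * zeta (2 * s - i)) else 0)"
    by (rule sum.cong) auto
  also have "\<dots> = 2 * E"
    unfolding sum_even_indices by (simp add: E_def sum_distrib_left)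
  finally have E: "(\<Sum>i=1..s. c i * ((if i = 1 then 0 else (1 + (-1) ^ i) * zeta i) * zeta (2 * s - i))) =
    2 * E" .
  \<comment> \<open>The ends \<open>i = 1\<close> and \<open>i = s\<close> are split off because
    each has its own evaluation; the rest is the sum sought, empty for \<open>s = 2\<close>.\<close>
  have "{1..s} = insert 1 (insert s {2..s - 1})"
    using assms by auto
  moreover have "c s = 1"
    using assms by (simp add: c_def mult_2)
  ultimately have L: "(\<Sum>i=1..s. c i * euler_sum i (2 * s - i)) =
      c 1 * euler_sum 1 (2 * s - 1) + euler_sum s s + L"
    using assms by (simp add: L_def mult_2)
  \<comment> \<open>The summand is symmetric since \<open>2 * s - k\<close> and \<open>k\<close>
    have the same parity.\<close>
  have "(\<Sum>k=2..2 * s - 2. (-1) ^ k * zeta k * zeta (2 * s - k)) =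
      2 * A - (-1) ^ s * zeta s * zeta (2 * s - s)"
    unfolding A_def using assms
    by (intro sum_symmetric_halves) (auto simp: uminus_power_if)
  then have A: "2 * euler_sum 1 (2 * s - 1) = 2 * A - (-1) ^ s * (zeta s)\<^sup>2"
    unfolding euler_sum_1[OF assms] by (simp add: power2_eq_square)
  have "(-1) ^ s * ((zeta s)\<^sup>2 - euler_sum s s) =
      2 * E - (c 1 * euler_sum 1 (2 * s - 1) + euler_sum s s + L)"
    using zeta_even_euler_sum[OF assms]
    by (simp only: c_def[symmetric] right_diff_distrib sum_subtractf E L)
  then have "2 * L = 4 * E - c 1 * (2 * euler_sum 1 (2 * s - 1)) - 2 * euler_sum s s -
      2 * (-1) ^ s * ((zeta s)\<^sup>2 - euler_sum s s)"
    by (simp add: algebra_simps)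
  then have "2 * L = 4 * E - c 1 * (2 * A - (-1) ^ s * (zeta s)\<^sup>2) - ((zeta s)\<^sup>2 + zeta (2 * s)) -
      (-1) ^ s * ((zeta s)\<^sup>2 - zeta (2 * s))"
    unfolding A diag by (simp add: field_simps)
  moreover obtain t where "s = Suc t"
    using assms by (cases s) auto
  then have "(-1) ^ (s - 1) = - ((-1) ^ s :: real)"
    by simp
  ultimately have "2 * L = 4 * E - 2 * c 1 * A -
      (-1) ^ (s - 1) * (zeta s)\<^sup>2 * (c 1 + (-1) ^ (s - 1) - 1) -
      (-1) ^ (s - 1) * zeta (2 * s) * ((-1) ^ (s - 1) + 1)"
    \<comment> \<open>Fixing the parity of \<open>s\<close> evaluates every sign, including the
      products of two signs on the right.\<close>
    by (cases "even s") (simp_all add: algebra_simps)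
  moreover have "c 1 = real ((2 * s - 2) choose (s - 1))"
    by (simp add: c_def numeral_2_eq_2)
  ultimately show ?thesis
    by (simp only: L_def E_def A_def c_def euler_sum_def)
qed

end
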